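(* Let $\mathcal{D} = 3^{2}\cdot 7^{2}\cdot 11^{2}\cdot 13^{2}\cdot 22021$ (where $22021 = 19^2\cdot 61$). Then $\mathcal{D}$ is the only cube-free Descartes number with fewer than eight distinct prime divisors.
   Context: $\sigma(k)$ denotes the sum of the positive divisors of $k$. An odd positive integer $n$ is called a Descartes number if there exist positive integers $k, m$ such that $n = km$ and $\sigma(k)(m+1) = 2km$. A Descartes number $n$ is called a cube-free Descartes number if there is no prime $p$ with $p^3 \mid n$.
   Formalization: The number n = 1 is excluded: with k = m = 1 it satisfies the stated definition of a cube-free Descartes number and has no prime divisors, so the claim is proved for all n different from 1. *)

theory Defs
  imports "HOL-Computational_Algebra.Primes"
begin

definition sigma :: "nat \<Rightarrow> nat" where
  "sigma k = (\<Sum>d | d dvd k. d)"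

definition descartes_number :: "nat \<Rightarrow> bool" where
  "descartes_number n \<longleftrightarrow> odd n \<and>
     (\<exists>k m. k > 0 \<and> m > 0 \<and> n = k * m \<and> sigma k * (m + 1) = 2 * k * m)"

definition cube_free_descartes_number :: "nat \<Rightarrow> bool" where
  "cube_free_descartes_number n \<longleftrightarrow>
     descartes_number n \<and> \<not> (\<exists>p. prime p \<and> p ^ 3 dvd n)"

definition descartes_D :: nat where
  "descartes_D = 3\<^sup>2 * 7\<^sup>2 * 11\<^sup>2 * 13\<^sup>2 * 22021"

lemma descartes_D_factorization:
  "descartes_D = 3\<^sup>2 * 7\<^sup>2 * 11\<^sup>2 * 13\<^sup>2 * 19\<^sup>2 * 61"
  by (simp add: descartes_D_def)

(* With k and m merely positive, 1 = 1 * 1 is a degenerate cube-free Descartes number. It is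
   the only one excluded by the usual requirement k, m > 1, as the next two lemmas show; this
   is why results on Descartes numbers have to exclude n = 1. *)

lemma cube_free_descartes_number_1: "cube_free_descartes_number 1"
proof -
  have "sigma 1 = 1" by (simp add: sigma_def)
  moreover have "\<not> (\<exists>p::nat. prime p \<and> p ^ 3 dvd 1)"
    by (metis is_unit_power_iff not_prime_unit zero_neq_numeral)
  ultimately show ?thesis
    unfolding cube_free_descartes_number_def descartes_number_def by auto
qed

lemma descartes_number_factors_gt_1:
  assumes "n \<noteq> 1"
  shows "descartes_number n \<longleftrightarrow> odd n \<and>
     (\<exists>k m. k > 1 \<and> m > 1 \<and> n = k * m \<and> sigma k * (m + 1) = 2 * k * m)"
proof -
  have "k > 1 \<and> m > 1"
    if pos: "k > 0" "m > 0" and n: "n = k * m" and eq: "sigma k * (m + 1) = 2 * k * m" for k m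
  proof -
    have "k \<noteq> 1"
    proof
      assume "k = 1"
      with eq have "m = 1" by (simp add: sigma_def)
      with n \<open>k = 1\<close> assms show False by simp
    qed
    moreover have "m \<noteq> 1"
    proof
      assume "m = 1"
      with eq have s: "sigma k = k" by simp
      have "(\<Sum>d\<in>{1, k}. d) \<le> sigma k"
        unfolding sigma_def by (rule sum_mono2) (use pos in auto)
      with s \<open>k \<noteq> 1\<close> show False by simp
    qed
    ultimately show ?thesis using pos by linarith
  qed
  then have "(\<exists>k m. k > 0 \<and> m > 0 \<and> n = k * m \<and> sigma k * (m + 1) = 2 * k * m) \<longleftrightarrow>
      (\<exists>k m. k > 1 \<and> m > 1 \<and> n = k * m \<and> sigma k * (m + 1) = 2 * k * m)"
    by (metis less_trans zero_less_one)
  then show ?thesis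
    unfolding descartes_number_def by blast
qed

end

(* Write n = k m with sigma k (m + 1) = 2 k m. Since n is odd, m = 1 (mod 4) and sigma k is odd, so
   by cube-freeness k is the product of the squares of a set S of primes, none of which divides m.
   Every prime factor of x^2 + x + 1 is 3 or congruent to 1 mod 3, and 9 never divides x^2 + x + 1.
   The abundancy sigma k / k = 2 m / (m + 1) forces 3 to be in S; then m = 1 (mod 3), and comparing
   powers of 3 shows that exactly two elements p < q of S are 1 mod 3. The set U of the remaining
   elements (all 2 mod 3) has at most three members, and every prime factor of sigma k other than 3
   is p, q or one of the at most 4 - card U primes of m. As the square of each u in U divides m + 1,
   the abundancy of k lies between 2 - 1 / (product of these squares) and 2. These two constraints
   leave only p = 7, q = 13, U = {11}. *)

theory Submission
  imports Defs "HOL-Number_Theory.Residues"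
begin

section \<open>The sum of divisors and the polynomial \<open>x\<^sup>2 + x + 1\<close>\<close>

text \<open>Each divisor of \<open>a * b\<close> splits uniquely into a divisor of \<open>a\<close>
  and one of \<open>b\<close>, so the sum over divisors factors.\<close>

lemma sigma_mult_coprime:
  assumes "coprime a b" "a > 0" "b > 0"
  shows "sigma (a * b) = sigma a * sigma b"
proof -
  have "bij_betw (\<lambda>(d, e). d * e) ({d. d dvd a} \<times> {e. e dvd b}) {d. d dvd a * b}"
    unfolding bij_betw_def
  proof
    show "inj_on (\<lambda>(d, e). d * e) ({d. d dvd a} \<times> {e. e dvd b})"
    proof (clarsimp simp: inj_on_def)
      fix d e d' e' assume *: "d dvd a" "e dvd b" "d' dvd a" "e' dvd b" "d * e = d' * e'"
      have "coprime d e'" "coprime d' e"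
        using * assms(1) by (blast intro: coprime_divisors)+
      with *(5) show "d = d' \<and> e = e'" by (simp add: coprime_crossproduct_nat)
    qed
    show "(\<lambda>(d, e). d * e) ` ({d. d dvd a} \<times> {e. e dvd b}) = {d. d dvd a * b}"
    proof (rule Set.set_eqI, rule iffI)
      fix x assume "x \<in> {d. d dvd a * b}"
      then obtain d e where "x = d * e" "d dvd a" "e dvd b" by (auto elim: dvd_productE)
      then show "x \<in> (\<lambda>(d, e). d * e) ` ({d. d dvd a} \<times> {e. e dvd b})" by force
    qed (auto intro: mult_dvd_mono)
  qed
  then have "sigma (a * b) = (\<Sum>(d, e)\<in>{d. d dvd a} \<times> {e. e dvd b}. d * e)"
    unfolding sigma_def by (subst sum.reindex_bij_betw [symmetric]) (auto simp: case_prod_unfold)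
  then show ?thesis
    by (simp add: sigma_def sum_product sum.cartesian_product)
qed

lemma sigma_prime:
  assumes p: "prime p" shows "sigma p = p + 1"
proof -
  have "{d. d dvd p} = {1, p}" using p by (auto dest: prime_nat_iff [THEN iffD1, THEN conjunct2, rule_format])
  then show ?thesis using prime_gt_1_nat [OF p] by (simp add: sigma_def)
qed

lemma sigma_prime_square: 
  assumes p: "prime p" shows "sigma (p\<^sup>2) = p\<^sup>2 + p + 1"
proof -
  have "{d. d dvd p\<^sup>2} = (\<lambda>i. p ^ i) ` {..2}"
    using p by (auto simp: divides_primepow_nat)
  also have "\<dots> = {1, p, p\<^sup>2}" by (simp add: numeral_2_eq_2 atMost_Suc insert_commute)
  finally show ?thesis using prime_gt_1_nat [OF p] by (simp add: sigma_def power2_eq_square)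
qed

lemma sigma_prod_prime_squares:
  assumes "finite S" "\<And>p. p \<in> S \<Longrightarrow> prime p"
  shows "sigma (\<Prod>p\<in>S. p\<^sup>2) = (\<Prod>p\<in>S. p\<^sup>2 + p + 1)"
  using assms
proof (induction S rule: finite_induct)
  case empty
  then show ?case by (simp add: sigma_def)
next
  case (insert p S)
  have "coprime (p\<^sup>2) (\<Prod>p\<in>S. p\<^sup>2)"
    using insert by (intro prod_coprime_right) (auto intro!: primes_coprime)
  moreover have "(\<Prod>p\<in>S. p\<^sup>2) > 0" "p\<^sup>2 > 0" using insert.prems by (auto intro!: prod_pos simp: prime_gt_0_nat)
  ultimately show ?case using insert by (simp add: sigma_mult_coprime sigma_prime_square)
qed

text \<open>If \<open>r mod 3 = 2\<close>, then \<open>r - 1\<close> is 1 modulo 3. Since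
  \<open>x ^ 3\<close> is 1 modulo \<open>r\<close>, Fermat's theorem makes \<open>x\<close> itself
  1 modulo \<open>r\<close>, so \<open>r\<close> divides 3, which is impossible.\<close>

lemma prime_dvd_cyclotomic3:
  fixes x r :: nat
  assumes r: "prime r" and dvd: "r dvd x\<^sup>2 + x + 1"
  shows "r = 3 \<or> r mod 3 = 1"
proof (rule ccontr)
  assume neg: "\<not> ?thesis"
  moreover have "\<not> 3 dvd r" using neg r primes_dvd_imp_eq [of 3 r] by auto
  ultimately have "r mod 3 = 2" by presburger
  then have r': "r - 1 = 3 * (r div 3) + 1" by presburger
  have "\<not> r dvd x"
  proof
    assume "r dvd x"
    then have "r dvd x\<^sup>2 + x" by (simp add: power2_eq_square)
    with dvd have "r dvd 1" by (metis dvd_add_right_iff)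
    with r show False by simp
  qed
  with r have "[x ^ (r - 1) = 1] (mod r)" by (rule fermat_theorem)
  moreover have "[x ^ 3 = 1] (mod r)"
  proof -
    \<comment> \<open>This is x^3 - 1 = (x - 1)(x^2 + x + 1), rearranged to avoid subtraction of
      naturals.\<close>
    have eq: "x ^ 3 + (x\<^sup>2 + x + 1) = x * (x\<^sup>2 + x + 1) + 1" by (simp add: algebra_simps power2_eq_square power3_eq_cube)
    have "[x ^ 3 + (x\<^sup>2 + x + 1) = x ^ 3 + 0] (mod r)"
      by (rule cong_add) (use dvd in \<open>simp_all only: cong_0_iff cong_refl\<close>)
    moreover have "[x * (x\<^sup>2 + x + 1) + 1 = 0 + 1] (mod r)"
      by (rule cong_add) (use dvd in \<open>simp_all only: cong_0_iff cong_refl dvd_mult\<close>)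
    ultimately show ?thesis unfolding eq by (simp add: cong_def)
  qed
  then have "[(x ^ 3) ^ (r div 3) * x = 1 ^ (r div 3) * x] (mod r)" by (intro cong_mult cong_pow) auto
  moreover have "x ^ (r - 1) = (x ^ 3) ^ (r div 3) * x"
    by (subst r') (simp add: power_mult)
  ultimately have "[x = 1] (mod r)" by (simp add: cong_def)
  then have "[x\<^sup>2 + x + 1 = 1\<^sup>2 + 1 + 1] (mod r)" by (intro cong_add cong_pow) auto
  with dvd have "r dvd 3" by (simp add: cong_dvd_iff numeral_3_eq_3)
  with neg r show False using primes_dvd_imp_eq [of r 3] by auto
qed

section \<open>Bounds for products and small primes\<close>

text \<open>Each element of \<open>S\<close> can be assigned its own entry of \<open>L\<close> that
  is no larger, and the remaining entries contribute factors of at least 1. \<open>L\<close> is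
  meant to list the smallest admissible values.\<close>

lemma prod_antimono_le_prod_list:
  fixes f :: "nat \<Rightarrow> real"
  assumes anti: "\<And>x y. 0 < x \<Longrightarrow> x \<le> y \<Longrightarrow> f y \<le> f x" and ge1: "\<And>x. f x \<ge> 1"
  assumes "finite S" "card S \<le> length L" "\<And>x. x \<in> S \<Longrightarrow> x \<in> set L \<or> x \<ge> N"
    "sorted L" "\<And>x. x \<in> set L \<Longrightarrow> 0 < x \<and> x \<le> N"
  shows "(\<Prod>x\<in>S. f x) \<le> (\<Prod>x\<leftarrow>L. f x)"
  using assms(3-)
proof (induction L arbitrary: S)
  case Nil
  then show ?case by simp
next
  case (Cons x L)
  show ?case
  proof (cases "S = {}")
    case True
    have "1 \<le> (\<Prod>x\<leftarrow>ys. f x)" for ys :: "nat list"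
      by (induction ys) (use ge1 in \<open>auto intro: mult_ge1_I\<close>)
    from this [of "x # L"] show ?thesis using True by simp
  next
    case False
    \<comment> \<open>Removing the head \<open>x\<close> itself whenever it lies in \<open>S\<close>
      keeps the hypotheses valid for the tail; any other choice of \<open>y\<close> is at least
      \<open>x\<close>.\<close>
    then obtain y where y: "y \<in> S" "x \<in> S \<longrightarrow> y = x" by (metis all_not_in_conv)
    have "(\<Prod>z\<in>S - {y}. f z) \<le> (\<Prod>z\<leftarrow>L. f z)"
      by (rule Cons.IH) (use Cons.prems y in auto)
    moreover have "f y \<le> f x"
      using Cons.prems(3)[OF y(1)] Cons.prems(4,5) by (intro anti) force+
    moreover have "0 \<le> (\<Prod>z\<in>S - {y}. f z)" by (intro prod_nonneg) (use ge1 order_trans zero_le_one in blast)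
    moreover have "0 \<le> f x" using ge1 [of x] by simp
    ultimately have "f y * (\<Prod>z\<in>S - {y}. f z) \<le> f x * (\<Prod>z\<leftarrow>L. f z)" by (intro mult_mono)
    with y Cons.prems(1) show ?thesis by (simp add: prod.remove [of S y])
  qed
qed

text \<open>The cutoff 103 is where an abundancy bound in \<open>U_singleton\<close> dismisses all
  larger \<open>q\<close>; the cutoff 71 of the next lemma is chosen for \<open>b\<close> in
  \<open>U_not_doubleton\<close>.\<close>

lemma prime_1_mod_3_cases:
  fixes x :: nat
  assumes "prime x" "x mod 3 = 1"
  shows "x \<in> {7, 13, 19, 31, 37, 43, 61, 67, 73, 79, 97} \<or> x \<ge> 103"
proof -
  have "\<forall>x\<in>set [0..<103]. prime x \<longrightarrow> x mod 3 = 1 \<longrightarrow>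
      x \<in> {7, 13, 19, 31, 37, 43, 61, 67, 73, 79, 97::nat}" by code_simp
  with assms show ?thesis by (auto simp: not_le)
qed

lemma prime_2_mod_3_cases:
  fixes x :: nat
  assumes "prime x" "odd x" "x mod 3 = 2"
  shows "x \<in> {5, 11, 17, 23, 29, 41, 47, 53, 59} \<or> x \<ge> 71"
proof -
  have "\<forall>x\<in>set [0..<71]. prime x \<longrightarrow> odd x \<longrightarrow> x mod 3 = 2 \<longrightarrow>
      x \<in> {5, 11, 17, 23, 29, 41, 47, 53, 59::nat}" by code_simp
  with assms show ?thesis by (auto simp: not_le)
qed

text \<open>For prime \<open>x\<close> this is \<open>sigma (x^2) / x^2\<close>, the factor that
  \<open>x\<close> contributes to the abundancy of \<open>k\<close>.\<close>

definition abundancy_sq :: "nat \<Rightarrow> real" where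
  "abundancy_sq x = 1 + 1 / x + 1 / x\<^sup>2"

lemma abundancy_sq_antimono:
  "0 < x \<Longrightarrow> x \<le> y \<Longrightarrow> abundancy_sq y \<le> abundancy_sq x"
  unfolding abundancy_sq_def
  by (intro add_mono divide_left_mono) (auto intro!: power_mono)

lemma abundancy_sq_ge_1: "abundancy_sq x \<ge> 1"
  by (simp add: abundancy_sq_def)

lemma abundancy_sq_mult: "0 < x \<Longrightarrow> abundancy_sq x * (real x)\<^sup>2 = real (x\<^sup>2 + x + 1)"
  by (simp add: abundancy_sq_def field_simps power2_eq_square)

text \<open>Divisors below \<open>k\<close> may equal \<open>n\<close>, so that one bound
  \<open>k\<close> serves small and large primes alike.\<close>

lemma prime_by_trial_division:
  fixes n :: nat
  assumes "1 < n" "n < k * k" "\<And>d. 1 < d \<Longrightarrow> d < k \<Longrightarrow> d dvd n \<Longrightarrow> d = n"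
  shows "prime n"
proof (rule ccontr)
  assume "\<not> prime n"
  then obtain d where d: "d dvd n" "d \<noteq> 1" "d \<noteq> n" using assms(1) unfolding prime_nat_iff by blast
  then obtain e where n: "n = d * e" by blast
  have "d \<noteq> 0" "e \<noteq> 0" "e \<noteq> 1" "e \<noteq> n" using n d assms(1) by (auto intro: Nat.gr0I)
  with n d assms(3)[of d] assms(3)[of e] have "k \<le> d" "k \<le> e" by (auto simp: not_less [symmetric])
  then have "k * k \<le> n" unfolding n by (rule mult_le_mono)
  with assms(2) show False by simp
qed

text \<open>These are the prime factors of values of x^2 + x + 1 on which the case analysis
  relies.\<close>

lemma prime_numerals:
  assumes "n \<in> set [7, 13, 19, 31, 37, 61, 67, 79, 97, 127, 307, 331, 631, 1723, 3541, 5113::nat]"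
  shows "prime n"
proof -
  \<comment> \<open>72 * 72 = 5184 exceeds 5113, the largest entry.\<close>
  have *: "1 < n \<and> n < 72 * 72 \<and> (\<forall>d\<in>set [2..<72]. d dvd n \<longrightarrow> d = n)"
    using assms by (simp del: set_upt; elim disjE; simp del: set_upt)
  show ?thesis
  proof (rule prime_by_trial_division)
    fix d assume "1 < d" "d < (72::nat)"
    then have "d \<in> set [2..<72]" unfolding set_upt by simp
    with * show "d dvd n \<Longrightarrow> d = n" by blast
  qed (use * in blast)+
qed

lemma prod_abundancy_sq:
  assumes "\<And>p. p \<in> S \<Longrightarrow> p > 0"
  shows "(\<Prod>p\<in>S. abundancy_sq p) * real (\<Prod>p\<in>S. p\<^sup>2) = real (\<Prod>p\<in>S. p\<^sup>2 + p + 1)"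
  unfolding of_nat_prod prod.distrib [symmetric]
  by (intro prod.cong) (simp_all only: abundancy_sq_mult assms of_nat_power)

section \<open>Powers of 3 and residues modulo 3\<close>

lemma three_dvd_cyclotomic3_iff: "3 dvd (x::nat)\<^sup>2 + x + 1 \<longleftrightarrow> x mod 3 = 1"
proof -
  have "x = 3 * (x div 3) \<or> x = 3 * (x div 3) + 1 \<or> x = 3 * (x div 3) + 2" by presburger
  then obtain y where "x = 3 * y \<or> x = 3 * y + 1 \<or> x = 3 * y + 2" by blast
  then have *: "\<exists>z. x mod 3 = 0 \<and> x\<^sup>2 + x + 1 = 3 * z + 1 \<or>
      x mod 3 = 1 \<and> x\<^sup>2 + x + 1 = 3 * z \<or> x mod 3 = 2 \<and> x\<^sup>2 + x + 1 = 3 * z + 1"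
  proof (elim disjE)
    assume "x = 3 * y"
    then show ?thesis
      by (intro exI [of _ "3 * y\<^sup>2 + y"]) (simp add: power2_eq_square algebra_simps)
  next
    assume x: "x = 3 * y + 1"
    then have "x mod 3 = 1" by presburger
    with x show ?thesis
      by (intro exI [of _ "3 * y\<^sup>2 + 3 * y + 1"]) (simp add: power2_eq_square algebra_simps)
  next
    assume x: "x = 3 * y + 2"
    then have "x mod 3 = 2" by presburger
    with x show ?thesis
      by (intro exI [of _ "3 * y\<^sup>2 + 5 * y + 2"]) (simp add: power2_eq_square algebra_simps)
  qed
  \<comment> \<open>With the quadratic abstracted to \<open>s\<close>, the claim is linear, as
    \<open>presburger\<close> requires.\<close>
  have "3 dvd s \<longleftrightarrow> r = 1"
    if "r = 0 \<and> s = 3 * z + 1 \<or> r = 1 \<and> s = 3 * z \<or> r = 2 \<and> s = 3 * z + 1" for r s z :: nat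
    using that by (elim disjE conjE; hypsubst; presburger)
  from * this show ?thesis by (rule exE)
qed

lemma nine_not_dvd_cyclotomic3: "\<not> 9 dvd (x::nat)\<^sup>2 + x + 1"
proof
  assume dvd: "9 dvd x\<^sup>2 + x + 1"
  then have "3 dvd x\<^sup>2 + x + 1" by (rule dvd_trans [rotated]) simp
  then have "x mod 3 = 1" by (simp only: three_dvd_cyclotomic3_iff)
  then have "x = 3 * (x div 3) + 1" by presburger
  then obtain y where x: "x = 3 * y + 1" by blast
  then have "x\<^sup>2 + x + 1 = 9 * (y\<^sup>2 + y) + 3" by (simp add: power2_eq_square algebra_simps)
  with dvd show False by presburger
qed

text \<open>Summed over \<open>S\<close>, this turns the exponent of 3 in \<open>sigma k\<close>
  into the number of elements of \<open>S\<close> that are 1 modulo 3.\<close>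

lemma multiplicity_three_cyclotomic3:
  "multiplicity 3 ((x::nat)\<^sup>2 + x + 1) = (if x mod 3 = 1 then 1 else 0)"
proof (cases "x mod 3 = 1")
  case True
  then have "3 ^ 1 dvd x\<^sup>2 + x + 1" by (simp only: power_one_right three_dvd_cyclotomic3_iff)
  moreover have "\<not> 3 ^ Suc 1 dvd x\<^sup>2 + x + 1" using nine_not_dvd_cyclotomic3 [of x] by simp
  ultimately have "multiplicity 3 (x\<^sup>2 + x + 1) = 1" by (rule multiplicity_eqI)
  then show ?thesis using True by simp
next
  case False
  then have "\<not> 3 dvd x\<^sup>2 + x + 1" unfolding three_dvd_cyclotomic3_iff .
  then have "multiplicity 3 (x\<^sup>2 + x + 1) = 0" by (rule not_dvd_imp_multiplicity_0)
  then show ?thesis using False by simp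
qed

lemma mod_3_eq_1_if_primes:
  fixes m :: nat
  assumes "m > 0" "\<And>r. prime r \<Longrightarrow> r dvd m \<Longrightarrow> r mod 3 = 1"
  shows "m mod 3 = 1"
  using assms
proof (induction m rule: less_induct)
  case (less m)
  show ?case
  proof (cases "m = 1")
    case False
    then obtain r where r: "prime r" "r dvd m" using prime_factor_nat by blast
    then obtain l where m: "m = r * l" by blast
    have "l < m" "l > 0" using m less.prems(1) prime_gt_1_nat [OF r(1)] by auto
    have "l mod 3 = 1"
    proof (rule less.IH [OF \<open>l < m\<close> \<open>l > 0\<close>])
      fix t assume "prime t" "t dvd l"
      then show "t mod 3 = 1" by (intro less.prems(2)) (simp_all add: m)
    qed
    then show ?thesis using less.prems(2) [OF r] mod_mult_eq [of r 3 l] unfolding m by simp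
  qed simp
qed

section \<open>Decompositions with \<open>k = (3 p q \<Prod>U)\<^sup>2\<close>\<close>

text \<open>The prime 3 is absorbed in the constants 13 = 3^2 + 3 + 1 and 18 = 2 * 3^2. Of at most
  seven primes, 3, \<open>p\<close> and \<open>q\<close> are already named, which leaves four for
  \<open>U\<close> and \<open>m\<close>.\<close>

locale descartes_core =
  fixes p q m :: nat and U :: "nat set"
  assumes p: "prime p" "p mod 3 = 1" and q: "prime q" "q mod 3 = 1" and p_less_q: "p < q"
    and U: "finite U" "\<And>u. u \<in> U \<Longrightarrow> prime u" "\<And>u. u \<in> U \<Longrightarrow> odd u" "\<And>u. u \<in> U \<Longrightarrow> u mod 3 = 2"
    and m: "m mod 4 = 1" "m mod 3 = 1"
    and eq: "13 * (p\<^sup>2 + p + 1) * (q\<^sup>2 + q + 1) * (\<Prod>u\<in>U. u\<^sup>2 + u + 1) * (m + 1) =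
      18 * p\<^sup>2 * q\<^sup>2 * (\<Prod>u\<in>U. u\<^sup>2) * m"
    and card_le: "card (prime_factors m) + card U \<le> 4"
begin

lemma m_pos: "m > 0" and m_odd: "odd m"
  using m by (cases "m = 0"; presburger)+

text \<open>A prime that is 2 modulo 3 divides no number of the form x^2 + x + 1, by
  \<open>prime_dvd_cyclotomic3\<close>.\<close>

lemma coprime_U_square:
  assumes "u \<in> U"
  shows "coprime (u\<^sup>2) (13 * (p\<^sup>2 + p + 1) * (q\<^sup>2 + q + 1) * (\<Prod>u\<in>U. u\<^sup>2 + u + 1))"
proof -
  have u: "prime u" "u mod 3 = 2" using U assms by auto
  have "\<not> u dvd x\<^sup>2 + x + 1" for x
    using prime_dvd_cyclotomic3 [of u x] u by auto
  \<comment> \<open>13 is the value of x^2 + x + 1 at 3.\<close>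
  moreover from this [of 3] have "\<not> u dvd 13" by simp
  ultimately have "\<not> u dvd 13 * (p\<^sup>2 + p + 1) * (q\<^sup>2 + q + 1) * (\<Prod>u\<in>U. u\<^sup>2 + u + 1)"
    using u(1) U(1) by (simp only: prime_dvd_mult_iff prime_dvd_prod_iff) blast
  then have "coprime u (13 * (p\<^sup>2 + p + 1) * (q\<^sup>2 + q + 1) * (\<Prod>u\<in>U. u\<^sup>2 + u + 1))"
    by (rule prime_imp_coprime [OF u(1)])
  then show ?thesis by (simp only: coprime_power_left_iff simp_thms)
qed

text \<open>The squares of \<open>U\<close> divide the right side of \<open>eq\<close> but are
  coprime to \<open>sigma k\<close>, so they go into \<open>m + 1\<close>, which also has the factor
  2.\<close>

lemma prod_squares_le: "2 * (\<Prod>u\<in>U. u\<^sup>2) \<le> m + 1"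
proof -
  let ?s = "13 * (p\<^sup>2 + p + 1) * (q\<^sup>2 + q + 1) * (\<Prod>u\<in>U. u\<^sup>2 + u + 1)"
  have "coprime (\<Prod>u\<in>U. u\<^sup>2) ?s"
    by (rule prod_coprime_left) (rule coprime_U_square)
  moreover have "(\<Prod>u\<in>U. u\<^sup>2) dvd ?s * (m + 1)"
    unfolding eq by simp
  ultimately have "(\<Prod>u\<in>U. u\<^sup>2) dvd m + 1" by (simp only: coprime_dvd_mult_right_iff)
  moreover have "2 dvd m + 1" using m_odd by simp
  moreover have "coprime 2 (\<Prod>u\<in>U. u\<^sup>2)"
    using U(3) by (intro prod_coprime_right) auto
  ultimately have "2 * (\<Prod>u\<in>U. u\<^sup>2) dvd m + 1" by (simp only: divides_mult)
  then show ?thesis by (rule dvd_imp_le) simp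
qed

text \<open>By \<open>eq\<close> such a prime divides the right side; 2 is excluded because
  \<open>sigma k\<close> is odd, and \<open>U\<close> by coprimality. As \<open>m\<close> has few
  prime factors, known factors of \<open>sigma k\<close> soon lead to a contradiction.\<close>

lemma prime_dvd_sigma:
  assumes r: "prime r" "r \<noteq> 3"
    and dvd: "r dvd 13 * (p\<^sup>2 + p + 1) * (q\<^sup>2 + q + 1) * (\<Prod>u\<in>U. u\<^sup>2 + u + 1)"
  shows "r = p \<or> r = q \<or> r \<in> prime_factors m"
proof (rule ccontr)
  assume neg: "\<not> ?thesis"
  have "r \<noteq> 2"
  proof
    assume "r = 2"
    moreover have "odd (x\<^sup>2 + x + 1)" for x :: nat by simp
    ultimately show False using dvd U(1) \<open>prime r\<close>
      by (simp only: prime_dvd_mult_iff prime_dvd_prod_iff) auto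
  qed
  have "r dvd 18 * p\<^sup>2 * q\<^sup>2 * (\<Prod>u\<in>U. u\<^sup>2) * m" using dvd_mult2 [OF dvd, of "m + 1"] unfolding eq .
  moreover have "\<not> r dvd p\<^sup>2" "\<not> r dvd q\<^sup>2" 
    using neg r p q by (metis prime_dvd_power primes_dvd_imp_eq)+
  moreover have "\<not> r dvd m" using neg r m_pos by (auto simp: prime_factors_dvd)
  moreover have "\<not> r dvd 18"
  proof
    assume "r dvd 18"
    then have "r dvd 2 * 3 * 3" by simp
    then have "r dvd 2 \<or> r dvd 3" using r by (metis prime_dvd_mult_iff)
    then show False using r \<open>r \<noteq> 2\<close> using primes_dvd_imp_eq [of r 2] primes_dvd_imp_eq [of r 3] by auto
  qed
  ultimately obtain u where u: "u \<in> U" "r dvd u\<^sup>2"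
    using r(1) U(1) by (simp only: prime_dvd_mult_iff prime_dvd_prod_iff) blast
  then have "r = u" using r U(2) by (metis prime_dvd_power primes_dvd_imp_eq)
  with coprime_U_square [OF u(1)] u(2) dvd have "is_unit r" by (blast intro: coprime_common_divisor)
  with r(1) show False by simp
qed

text \<open>The left side is \<open>sigma k / k\<close>; dividing \<open>eq\<close> by
  \<open>k * (m + 1)\<close> gives 2 m / (m + 1).\<close>

lemma abundancy_eq:
  "13 / 9 * abundancy_sq p * abundancy_sq q * (\<Prod>u\<in>U. abundancy_sq u) = 2 - 2 / (m + 1)"
proof -
  have pos: "p > 0" "q > 0" "\<And>u. u \<in> U \<Longrightarrow> u > 0" using p q U(2) prime_gt_0_nat by auto
  have "(\<Prod>u\<in>U. abundancy_sq u) * (\<Prod>u\<in>U. (real u)\<^sup>2) = real (\<Prod>u\<in>U. u\<^sup>2 + u + 1)"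
    using prod_abundancy_sq [of U] pos(3) by simp
  moreover have P: "(\<Prod>u\<in>U. (real u)\<^sup>2) > 0" using pos by (intro prod_pos) auto
  moreover have "real 13 * real (p\<^sup>2 + p + 1) * real (q\<^sup>2 + q + 1) * real (\<Prod>u\<in>U. u\<^sup>2 + u + 1) * (real m + 1) =
      18 * (real p)\<^sup>2 * (real q)\<^sup>2 * (\<Prod>u\<in>U. (real u)\<^sup>2) * real m"
    using arg_cong [OF eq, of real] by (simp only: of_nat_mult of_nat_add of_nat_1 of_nat_prod of_nat_power of_nat_numeral)
  ultimately have "13 * (abundancy_sq p * (real p)\<^sup>2) * (abundancy_sq q * (real q)\<^sup>2) *
      ((\<Prod>u\<in>U. abundancy_sq u) * (\<Prod>u\<in>U. (real u)\<^sup>2)) * (real m + 1) =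
      18 * (real p)\<^sup>2 * (real q)\<^sup>2 * (\<Prod>u\<in>U. (real u)\<^sup>2) * real m"
    by (simp only: abundancy_sq_mult [OF pos(1)] abundancy_sq_mult [OF pos(2)] of_nat_numeral)
  then have "(13 * abundancy_sq p * abundancy_sq q * (\<Prod>u\<in>U. abundancy_sq u) * (real m + 1)) *
      ((real p)\<^sup>2 * (real q)\<^sup>2 * (\<Prod>u\<in>U. (real u)\<^sup>2)) =
      (18 * real m) * ((real p)\<^sup>2 * (real q)\<^sup>2 * (\<Prod>u\<in>U. (real u)\<^sup>2))"
    by (simp only: mult_ac)
  then have "13 * abundancy_sq p * abundancy_sq q * (\<Prod>u\<in>U. abundancy_sq u) * (real m + 1) = 18 * real m"
    using P pos by simp
  then show ?thesis by (simp add: field_simps)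
qed

text \<open>By \<open>prod_squares_le\<close>, \<open>m + 1\<close> is at least
  \<open>2 * Q\<close>, so the abundancy is within \<open>1 / Q\<close> of 2. This refutes cases
  whose primes are too large: \<open>x\<close> and \<open>y\<close> bound \<open>p\<close> and
  \<open>q\<close> from below, and \<open>A\<close> bounds the product over \<open>U\<close> from
  above.\<close>

lemma abundancy_lower:
  assumes "0 < x" "x \<le> p" "0 < y" "y \<le> q" "(\<Prod>u\<in>U. abundancy_sq u) \<le> A"
    and Q: "Q \<le> real (\<Prod>u\<in>U. u\<^sup>2)" "0 < Q"
  shows "2 - 1 / Q \<le> 13 / 9 * abundancy_sq x * abundancy_sq y * A"
proof -
  have "2 * Q \<le> 2 * real (\<Prod>u\<in>U. u\<^sup>2)" using Q by simp
  also have "\<dots> = real (2 * (\<Prod>u\<in>U. u\<^sup>2))" by simp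
  also have "\<dots> \<le> real (m + 1)" using prod_squares_le by (rule of_nat_mono)
  finally have "2 / real (m + 1) \<le> 2 / (2 * Q)" using \<open>0 < Q\<close> by (intro divide_left_mono) auto
  then have "2 - 1 / Q \<le> 2 - 2 / (m + 1)" by simp
  also have "\<dots> = 13 / 9 * abundancy_sq p * abundancy_sq q * (\<Prod>u\<in>U. abundancy_sq u)"
    by (rule abundancy_eq [symmetric])
  also have "\<dots> \<le> 13 / 9 * abundancy_sq x * abundancy_sq y * A"
    using assms(1-5) order_trans [OF zero_le_one abundancy_sq_ge_1]
    by (intro mult_mono abundancy_sq_antimono) (auto intro!: mult_nonneg_nonneg prod_nonneg)
  finally show ?thesis .
qed

text \<open>Since \<open>abundancy_sq 0 = 1\<close> by the convention \<open>1 / 0 = 0\<close>, taking \<open>y = 0\<close> drops the factor of \<open>q\<close>.\<close>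

lemma abundancy_upper:
  assumes "abundancy_sq x \<le> abundancy_sq p" "abundancy_sq y \<le> abundancy_sq q \<or> y = 0"
    and "A \<le> (\<Prod>u\<in>U. abundancy_sq u)" "A \<ge> 0"
  shows "13 / 9 * abundancy_sq x * abundancy_sq y * A < 2"
proof -
  have "abundancy_sq 0 = 1" by (simp add: abundancy_sq_def)
  then have "13 / 9 * abundancy_sq x * abundancy_sq y * A \<le>
      13 / 9 * abundancy_sq p * abundancy_sq q * (\<Prod>u\<in>U. abundancy_sq u)"
    using assms order_trans [OF zero_le_one abundancy_sq_ge_1] abundancy_sq_ge_1 [of q]
    by (intro mult_mono) (auto intro!: mult_nonneg_nonneg prod_nonneg)
  also have "\<dots> = 2 - 2 / (m + 1)" by (rule abundancy_eq)
  also have "\<dots> < 2" by simp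
  finally show ?thesis .
qed

section \<open>Case analysis by the size of \<open>U\<close>\<close>

lemma p_ge: "p \<ge> 7" and q_ge: "q \<ge> 13"
  using prime_1_mod_3_cases [OF p] prime_1_mod_3_cases [OF q] p_less_q by auto

lemma p_cases: "p = 7 \<or> p = 13 \<or> p = 19 \<or> p = 31 \<or> p \<ge> 37"
  using prime_1_mod_3_cases [OF p] by auto

lemma q_cases: "q = 13 \<or> q = 19 \<or> q = 31 \<or> q \<ge> 37"
  using prime_1_mod_3_cases [OF q] q_ge by auto

lemma U_not_empty: "U \<noteq> {}"
proof
  assume "U = {}"
  have "m \<noteq> 1"
  proof
    assume "m = 1"
    then have "13 / 9 * abundancy_sq p * abundancy_sq q = 1" using abundancy_eq \<open>U = {}\<close> by simp
    moreover have "13 / 9 * 1 * 1 \<le> 13 / 9 * abundancy_sq p * abundancy_sq q"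
      using abundancy_sq_ge_1 order_trans [OF zero_le_one abundancy_sq_ge_1] by (intro mult_mono) auto
    ultimately show False by simp
  qed
  \<comment> \<open>\<open>m\<close> is 1 modulo 12.\<close>
  then have "m \<ge> 13" using m by presburger
  then have "2 - 2 / 14 \<le> 2 - 2 / (real m + 1)" by (simp add: field_simps)
  also have "\<dots> = 13 / 9 * abundancy_sq p * abundancy_sq q"
    using abundancy_eq \<open>U = {}\<close> by simp
  also have "\<dots> \<le> 13 / 9 * abundancy_sq 7 * abundancy_sq 13"
    using p_ge q_ge order_trans [OF zero_le_one abundancy_sq_ge_1]
    by (intro mult_mono abundancy_sq_antimono) auto
  finally show False by (simp add: abundancy_sq_def)
qed

text \<open>The bounds \<open>low\<close> and \<open>up\<close> confine the primes to the claimed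
  solution or to \<open>a = 5\<close>, \<open>p = 13\<close> with seven values of \<open>q\<close>,
  for which \<open>eq\<close> has no integral \<open>m\<close>.\<close>

lemma U_singleton:
  assumes "U = {a}"
  shows "p = 7 \<and> q = 13 \<and> a = 11"
proof -
  have low: "2 - 1 / (real z)\<^sup>2 \<le> 13 / 9 * abundancy_sq x * abundancy_sq y * abundancy_sq z"
    if "0 < x" "x \<le> p" "0 < y" "y \<le> q" "0 < z" "z \<le> a" for x y z
    using that abundancy_lower [of x y "abundancy_sq z" "(real z)\<^sup>2"] assms
    by (simp add: abundancy_sq_antimono power_mono)
  have up: "13 / 9 * abundancy_sq x * abundancy_sq y * abundancy_sq z < 2"
    if "p \<le> x" "q \<le> y \<or> y = 0" "a \<le> z" for x y z
    using that assms p_ge q_ge U(2) [of a] order_trans [OF zero_le_one abundancy_sq_ge_1]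
    by (intro abundancy_upper) (auto intro!: abundancy_sq_antimono simp: prime_gt_0_nat)
  have a: "a = 5 \<or> a = 11 \<or> a \<ge> 17" using prime_2_mod_3_cases [of a] U assms by auto
  note q_list = prime_1_mod_3_cases [OF q]
  consider "a = 5" | "a = 11" | "a \<ge> 17" using a by blast
  then show ?thesis
  proof cases
    assume a: "a = 5"
    \<comment> \<open>The squares of 3, 5 and 7 alone already have abundancy above 2.\<close>
    have "p \<noteq> 7" using up [of 7 0 5] a by (auto simp: abundancy_sq_def)
    then have p13: "p = 13 \<or> p \<ge> 19" using p_cases by auto
    have "\<not> p \<ge> 19"
    proof
      assume "p \<ge> 19"
      then have "q \<ge> 31" using q_cases p_less_q by auto
      with low [of 19 31 5] \<open>p \<ge> 19\<close> a show False by (simp add: abundancy_sq_def)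
    qed
    with p13 have p: "p = 13" by simp
    have "\<not> q \<le> 31" using up [of 13 31 5] a p by (auto simp: abundancy_sq_def)
    moreover have "\<not> q \<ge> 103" using low [of 13 103 5] a p by (auto simp: abundancy_sq_def)
    ultimately have q: "q = 37 \<or> q = 43 \<or> q = 61 \<or> q = 67 \<or> q = 73 \<or> q = 79 \<or> q = 97"
      using q_list by auto
    have *: "13 * 183 * (q\<^sup>2 + q + 1) * 31 * (m + 1) = 18 * 169 * q\<^sup>2 * 25 * m"
      using eq a p assms by simp
    txt \<open>For each \<open>q\<close> the solution \<open>m\<close> of this linear equation lies strictly between two consecutive integers.\<close>
    from q have False
    proof (elim disjE)
      assume "q = 37"
      with * show False by (cases "m \<le> 298") auto
    next
      assume "q = 43"
      with * show False by (cases "m \<le> 138") auto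
    next
      assume "q = 61"
      with * show False by (cases "m \<le> 69") auto
    next
      assume "q = 67"
      with * show False by (cases "m \<le> 63") auto
    next
      assume "q = 73"
      with * show False by (cases "m \<le> 58") auto
    next
      assume "q = 79"
      with * show False by (cases "m \<le> 55") auto
    next
      assume "q = 97"
      with * show False by (cases "m \<le> 48") auto
    qed
    then show ?thesis ..
  next
    assume a: "a = 11"
    have "\<not> q \<ge> 19" using low [of 7 19 11] a p_ge by (auto simp: abundancy_sq_def)
    with q_cases q_ge have "q = 13" by auto
    moreover from this p_less_q p_cases have "p = 7" by auto
    ultimately show ?thesis using a by simp
  next
    assume "a \<ge> 17"
    with low [of 7 13 17] p_ge q_ge show ?thesis by (simp add: abundancy_sq_def)
  qed
qed

text \<open>Here \<open>m\<close> has at most two prime factors. Every known element x of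
  \<open>S\<close> yields primes dividing x^2 + x + 1; those other than 3, \<open>p\<close> and
  \<open>q\<close> must divide \<open>m\<close>, and a third one is a contradiction. Abundancy
  bounds settle the other cases.\<close>

lemma U_not_doubleton:
  assumes "U = {a, b}" "a < b"
  shows False
proof -
  let ?T = "prime_factors m"
  have ab: "prime a" "odd a" "a mod 3 = 2" "prime b" "odd b" "b mod 3 = 2" using U assms by auto
  note q_list = prime_1_mod_3_cases [OF q]
  note a_cases = prime_2_mod_3_cases [OF ab(1-3)] and b_cases = prime_2_mod_3_cases [OF ab(4-6)]
  have pos: "0 < a" "0 < b" using ab by (simp_all add: prime_gt_0_nat)
  have "card ?T \<le> 2" using card_le assms by simp
  have no3: False if "x \<in> ?T" "y \<in> ?T" "z \<in> ?T" "x \<noteq> y" "x \<noteq> z" "y \<noteq> z" for x y z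
    using card_mono [of ?T "{x, y, z}"] that \<open>card ?T \<le> 2\<close> by simp
  \<comment> \<open>The alternative \<open>x = 13\<close> stands for the prime 3 in
    \<open>S\<close>.\<close>
  have dvd: "x = p \<or> x = q \<or> x \<in> ?T"
    if "x \<in> set [7, 13, 19, 31, 37, 61, 67, 79, 97, 127, 307, 331, 631, 1723, 3541, 5113]"
      "x = 13 \<or> x dvd p\<^sup>2 + p + 1 \<or> x dvd q\<^sup>2 + q + 1 \<or> x dvd a\<^sup>2 + a + 1 \<or> x dvd b\<^sup>2 + b + 1" for x
  proof (rule prime_dvd_sigma)
    show "prime x" using that(1) by (intro prime_numerals) auto
    show "x \<noteq> 3" using that(1) by auto
    have prod: "(\<Prod>u\<in>U. u\<^sup>2 + u + 1) = (a\<^sup>2 + a + 1) * (b\<^sup>2 + b + 1)" using assms by simp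
    show "x dvd 13 * (p\<^sup>2 + p + 1) * (q\<^sup>2 + q + 1) * (\<Prod>u\<in>U. u\<^sup>2 + u + 1)"
      using that(2) unfolding prod by (elim disjE) (simp_all only: dvd_refl dvd_mult dvd_mult2)
  qed
  have low: "2 - 1 / ((real z)\<^sup>2 * (real w)\<^sup>2) \<le>
      13 / 9 * abundancy_sq x * abundancy_sq y * (abundancy_sq z * abundancy_sq w)"
    if "0 < x" "x \<le> p" "0 < y" "y \<le> q" "0 < z" "z \<le> a" "0 < w" "w \<le> b" for x y z w
    using that assms order_trans [OF zero_le_one abundancy_sq_ge_1]
    by (intro abundancy_lower) (auto intro!: mult_mono abundancy_sq_antimono power_mono)
  have up: "13 / 9 * abundancy_sq x * abundancy_sq y * (abundancy_sq z * abundancy_sq w) < 2"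
    if "p \<le> x" "q \<le> y \<or> y = 0" "a \<le> z" "b \<le> w \<or> w = 0" for x y z w
  proof (rule abundancy_upper)
    have "abundancy_sq 0 = 1" by (simp add: abundancy_sq_def)
    then have "abundancy_sq w \<le> abundancy_sq b" using that pos abundancy_sq_ge_1 abundancy_sq_antimono by metis
    with that pos assms show "abundancy_sq z * abundancy_sq w \<le> (\<Prod>u\<in>U. abundancy_sq u)"
      using order_trans [OF zero_le_one abundancy_sq_ge_1] by (auto intro!: mult_mono abundancy_sq_antimono)
  qed (use that p_ge q_ge order_trans [OF zero_le_one abundancy_sq_ge_1] in \<open>auto intro!: abundancy_sq_antimono\<close>)
  note num = abundancy_sq_def
  have a_cases': "a = 5 \<or> a = 11 \<or> a = 17 \<or> a \<ge> 23" using a_cases by auto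
  have b_cases': "b = 5 \<or> b = 11 \<or> b = 17 \<or> b = 23 \<or> b = 29 \<or> b \<ge> 41" using b_cases by auto
  consider (a5) "a = 5" "b \<ge> 11" | (a11) "a \<ge> 11" "b \<ge> 17"
    using a_cases' b_cases' assms(2) by linarith
  then show False
  proof cases
    case a5
    have "13 = p \<or> 13 = q \<or> 13 \<in> ?T" by (rule dvd) auto
    \<comment> \<open>31 = 5^2 + 5 + 1.\<close>
    have d31: "31 = p \<or> 31 = q \<or> 31 \<in> ?T" by (rule dvd) (auto simp: a5)
    have "p \<noteq> 7" using up [of 7 0 5 0] a5 by (auto simp: num)
    then consider (p13) "p = 13" | (p19) "p = 19" "q \<ge> 31" | (p31) "p \<ge> 31" "q \<ge> 37"
      using p_cases q_cases p_less_q by linarith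
    then show False
    proof cases
      case p13
      \<comment> \<open>13^2 + 13 + 1 = 3 * 61.\<close>
      have d61: "61 = p \<or> 61 = q \<or> 61 \<in> ?T" by (rule dvd) (auto simp: p13)
      have "\<not> q \<le> 31" using up [of 13 31 5 0] a5 p13 by (auto simp: num)
      then have q: "q \<ge> 37" and T31: "31 \<in> ?T" using q_cases d31 p13 by auto
      have "\<not> b \<le> 29" using up [of 13 0 5 29] a5 p13 by (auto simp: num)
      show False
      proof (cases "q = 61")
        case True
        \<comment> \<open>61^2 + 61 + 1 = 3 * 13 * 97.\<close>
        have "97 = p \<or> 97 = q \<or> 97 \<in> ?T" by (rule dvd) (auto simp: True)
        then have T97: "97 \<in> ?T" using True p13 by auto
        have "\<not> b \<le> 59" using up [of 13 61 5 59] a5 p13 True by (auto simp: num)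
        moreover have "\<not> b \<ge> 73" using low [of 13 61 5 73] a5 p13 True by (auto simp: num)
        \<comment> \<open>The bounds leave 71 and 72, and 72 is even. Then 71^2 + 71 + 1 = 5113 is a
          third prime for \<open>m\<close>.\<close>
        ultimately have "b = 71" using b_cases ab(5) by (cases "b = 72") auto
        then have "5113 = p \<or> 5113 = q \<or> 5113 \<in> ?T" by (intro dvd) auto
        then show False using no3 [OF T31 T97, of 5113] p13 True by auto
      next
        case False
        with d61 p13 have T61: "61 \<in> ?T" by auto
        have "q \<noteq> 37"
        proof
          assume "q = 37"
          \<comment> \<open>37^2 + 37 + 1 = 3 * 7 * 67; below, 43 gives 3 * 631.\<close>
          then have "67 = p \<or> 67 = q \<or> 67 \<in> ?T" by (intro dvd) auto
          then show False using no3 [OF T31 T61, of 67] p13 \<open>q = 37\<close> by auto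
        qed
        moreover have "q \<noteq> 43"
        proof
          assume "q = 43"
          then have "631 = p \<or> 631 = q \<or> 631 \<in> ?T" by (intro dvd) auto
          then show False using no3 [OF T31 T61, of 631] p13 \<open>q = 43\<close> by auto
        qed
        ultimately have q: "q \<ge> 67" using q False q_list by auto
        \<comment> \<open>The first four values of \<open>b\<close> give 1723, 37 * 61, 7 * 409 and
          3541. As 31 and 61 exhaust the primes of \<open>m\<close>, one new prime from each would
          have to be \<open>q\<close>: 37 and 7 are too small, 1723 and 3541 too large for
          \<open>low\<close>.\<close>
        consider "b = 41" | "b = 47" | "b = 53" | "b = 59" | "b \<ge> 71"
          using b_cases \<open>\<not> b \<le> 29\<close> by auto
        then show False
        proof cases
          assume b: "b = 41"
          then have "1723 = p \<or> 1723 = q \<or> 1723 \<in> ?T" by (intro dvd) auto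
          then have "q = 1723" using no3 [OF T31 T61, of 1723] p13 by auto
          then show False using low [of 13 1723 5 41] a5 b p13 by (simp add: num)
        next
          assume b: "b = 47"
          then have "37 = p \<or> 37 = q \<or> 37 \<in> ?T" by (intro dvd) auto
          then show False using no3 [OF T31 T61, of 37] p13 q by auto
        next
          assume b: "b = 53"
          then have "7 = p \<or> 7 = q \<or> 7 \<in> ?T" by (intro dvd) auto
          then show False using no3 [OF T31 T61, of 7] p13 q by auto
        next
          assume b: "b = 59"
          then have "3541 = p \<or> 3541 = q \<or> 3541 \<in> ?T" by (intro dvd) auto
          then have "q = 3541" using no3 [OF T31 T61, of 3541] p13 by auto
          then show False using low [of 13 3541 5 59] a5 b p13 by (simp add: num)
        next
          assume "b \<ge> 71"
          then show False using low [of 13 67 5 71] a5 q p13 by (simp add: num)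
        qed
      qed
    next
      case p19
      have T13: "13 \<in> ?T" using \<open>13 = p \<or> 13 = q \<or> 13 \<in> ?T\<close> p19 by auto
      \<comment> \<open>19^2 + 19 + 1 = 3 * 127; for \<open>q = 31\<close> the value is 3 *
        331.\<close>
      have d127: "127 = p \<or> 127 = q \<or> 127 \<in> ?T" by (rule dvd) (auto simp: p19)
      have "q \<noteq> 31"
      proof
        assume "q = 31"
        then have "331 = p \<or> 331 = q \<or> 331 \<in> ?T" by (intro dvd) auto
        with d127 show False using no3 [OF T13, of 127 331] p19 \<open>q = 31\<close> by auto
      qed
      then have "31 \<in> ?T" using d31 p19 by auto
      then have "q = 127" using d127 p19 no3 [OF T13, of 31 127] by auto
      \<comment> \<open>The lower bound excludes 23 and above, the upper bound everything up to 17,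
        and no candidate lies between.\<close>
      moreover from this have "b < 23" using low [of 19 127 5 23] a5 p19 by (cases "b < 23") (auto simp: num)
      then have "b \<le> 17" using b_cases by auto
      ultimately show False using up [of 19 127 5 17] a5 p19 by (simp add: num)
    next
      case p31
      have T13: "13 \<in> ?T" using \<open>13 = p \<or> 13 = q \<or> 13 \<in> ?T\<close> p31 by auto
      have "\<not> b \<ge> 29" using low [of 31 37 5 29] a5 p31 by (auto simp: num)
      then consider "b = 11" | "b = 17" | "b = 23" using b_cases a5 by auto
      then show False
      proof cases
        assume b: "b = 11"
        \<comment> \<open>11^2 + 11 + 1 = 7 * 19.\<close>
        have "7 = p \<or> 7 = q \<or> 7 \<in> ?T" "19 = p \<or> 19 = q \<or> 19 \<in> ?T" using b by (intro dvd; auto)+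
        then show False using no3 [OF T13, of 7 19] p31 by auto
      next
        assume b: "b = 17"
        \<comment> \<open>307 = 17^2 + 17 + 1.\<close>
        have d307: "307 = p \<or> 307 = q \<or> 307 \<in> ?T" using b by (intro dvd) auto
        show False
        proof (cases "p = 31")
          case True
          then have "331 = p \<or> 331 = q \<or> 331 \<in> ?T" by (intro dvd) auto
          with d307 True have "q \<ge> 307" using no3 [OF T13, of 307 331] by auto
          then show False using low [of 31 307 5 17] a5 b p31 by (simp add: num)
        next
          case False
          with p31 p_cases have p37: "p \<ge> 37" by auto
          then have "31 \<in> ?T" using d31 p31 by auto
          then have "307 = p \<or> 307 = q" using d307 no3 [OF T13, of 31 307] by auto
          then have "q \<ge> 307" using p_less_q by auto
          then show False using low [of 37 307 5 17] a5 b p37 by (simp add: num)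
        qed
      next
        assume b: "b = 23"
        \<comment> \<open>23^2 + 23 + 1 = 7 * 79.\<close>
        have "7 = p \<or> 7 = q \<or> 7 \<in> ?T" "79 = p \<or> 79 = q \<or> 79 \<in> ?T" using b by (intro dvd; auto)+
        then have "7 \<in> ?T" "79 = p \<or> 79 = q \<or> 79 \<in> ?T" using p31 by auto
        \<comment> \<open>7 and 13 exhaust the primes of \<open>m\<close>, so 79 is \<open>p\<close>
          or \<open>q\<close>.\<close>
        then have "q \<ge> 79" using no3 [OF T13, of 7 31] no3 [OF T13, of 7 79] d31 p31 p_less_q by auto
        then show False using low [of 31 79 5 23] a5 b p31 by (simp add: num)
      qed
    qed
  next
    case a11
    have p7: "p = 7"
    proof (rule ccontr)
      assume "p \<noteq> 7"
      then have "p \<ge> 13" "q \<ge> 19" using p_cases q_cases p_less_q by auto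
      then show False using low [of 13 19 11 17] a11 by (simp add: num)
    qed
    have d13: "13 = q \<or> 13 \<in> ?T" using dvd [of 13] p7 by auto
    \<comment> \<open>7^2 + 7 + 1 = 3 * 19.\<close>
    have d19: "19 = q \<or> 19 \<in> ?T" using dvd [of 19] p7 by auto
    consider (q13) "q = 13" | (q19) "q = 19" | (q31) "q \<ge> 31" using q_cases by linarith
    then show False
    proof cases
      case q13
      have "61 = p \<or> 61 = q \<or> 61 \<in> ?T" by (rule dvd) (auto simp: q13)
      then have T: "19 \<in> ?T" "61 \<in> ?T" using d19 q13 p7 by auto
      consider "a = 11" | "a = 17" | "a \<ge> 23" "b \<ge> 29"
        using a_cases' b_cases' assms(2) a11 by linarith
      then show False
      proof cases
        assume a: "a = 11"
        txt \<open>The primes \<open>3, 7, 11, 13\<close> alone have abundancy \<open>2 - 1 / 11011\<close>, which leaves only \<open>b = 22022\<close>.\<close>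
        have "\<not> b \<le> 22021" using up [of 7 13 11 22021] a q13 p7 by (auto simp: num)
        moreover have "b \<noteq> 22022" using ab(5) by auto
        ultimately have "b \<ge> 22023" by simp
        then show False using low [of 7 13 11 22023] a q13 p7 by (simp add: num)
      next
        assume "a = 17"
        then have "307 = p \<or> 307 = q \<or> 307 \<in> ?T" by (intro dvd) auto
        then show False using no3 [OF T, of 307] p7 q13 by auto
      next
        assume "a \<ge> 23" "b \<ge> 29"
        then show False using low [of 7 13 23 29] q13 p7 by (simp add: num)
      qed
    next
      case q19
      consider "a = 11" "b \<le> 29" | "a = 11" "b \<ge> 41" | "a \<ge> 17" "b \<ge> 23"
        using a_cases' b_cases' assms(2) a11 by linarith
      then show False
      proof cases
        assume "a = 11" "b \<le> 29"
        then show False using up [of 7 19 11 29] q19 p7 by (simp add: num)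
      next
        assume "a = 11" "b \<ge> 41"
        then show False using low [of 7 19 11 41] q19 p7 by (simp add: num)
      next
        assume "a \<ge> 17" "b \<ge> 23"
        then show False using low [of 7 19 17 23] q19 p7 by (simp add: num)
      qed
    next
      case q31
      then have T: "13 \<in> ?T" "19 \<in> ?T" using d13 d19 by auto
      consider "a = 11" "b = 17" | "a = 11" "b = 23" | "a = 11" "b \<ge> 29" | "a \<ge> 17" "b \<ge> 23"
        using a_cases' b_cases' assms(2) a11 by linarith
      then show False
      proof cases
        assume *: "a = 11" "b = 17"
        then have "307 = p \<or> 307 = q \<or> 307 \<in> ?T" by (intro dvd) auto
        then have "q = 307" using no3 [OF T, of 307] p7 by auto
        then show False using low [of 7 307 11 17] * p7 by (simp add: num)
      next
        assume *: "a = 11" "b = 23"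
        then have "79 = p \<or> 79 = q \<or> 79 \<in> ?T" by (intro dvd) auto
        then have "q = 79" using no3 [OF T, of 79] p7 by auto
        then show False using low [of 7 79 11 23] * p7 by (simp add: num)
      next
        assume "a = 11" "b \<ge> 29"
        then show False using low [of 7 31 11 29] q31 p7 by (simp add: num)
      next
        assume "a \<ge> 17" "b \<ge> 23"
        then show False using low [of 7 31 17 23] q31 p7 by (simp add: num)
      qed
    qed
  qed
qed

text \<open>Now \<open>m\<close> has at most one prime factor, so two primes of
  \<open>sigma k\<close> other than 3, \<open>p\<close> and \<open>q\<close> already give a
  contradiction.\<close>

lemma U_not_tripleton:
  assumes "U = {a, b, c}" "a < b" "b < c"
  shows False
proof -
  let ?T = "prime_factors m"
  have abc: "prime a" "odd a" "a mod 3 = 2" "prime b" "odd b" "b mod 3 = 2" "prime c" "odd c" "c mod 3 = 2"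
    using U assms by auto
  note a_cases = prime_2_mod_3_cases [OF abc(1-3)] and b_cases = prime_2_mod_3_cases [OF abc(4-6)]
    and c_cases = prime_2_mod_3_cases [OF abc(7-9)]
  have "card ?T \<le> 1" using card_le assms by simp
  then have no2: False if "x \<in> ?T" "y \<in> ?T" "x \<noteq> y" for x y
    using card_mono [of ?T "{x, y}"] that by simp
  have dvd: "x = p \<or> x = q \<or> x \<in> ?T"
    if "x \<in> set [7, 13, 19, 31, 61, 97, 127, 331]"
      "x = 13 \<or> x dvd p\<^sup>2 + p + 1 \<or> x dvd q\<^sup>2 + q + 1 \<or> x dvd a\<^sup>2 + a + 1" for x
  proof (rule prime_dvd_sigma)
    show "prime x" using that(1) by (intro prime_numerals) auto
    show "x \<noteq> 3" using that(1) by auto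
    have prod: "(\<Prod>u\<in>U. u\<^sup>2 + u + 1) = (a\<^sup>2 + a + 1) * ((b\<^sup>2 + b + 1) * (c\<^sup>2 + c + 1))" using assms by simp
    show "x dvd 13 * (p\<^sup>2 + p + 1) * (q\<^sup>2 + q + 1) * (\<Prod>u\<in>U. u\<^sup>2 + u + 1)"
      using that(2) unfolding prod by (elim disjE) (simp_all only: dvd_refl dvd_mult dvd_mult2)
  qed
  have low: "2 - 1 / ((real z)\<^sup>2 * ((real w)\<^sup>2 * (real v)\<^sup>2)) \<le>
      13 / 9 * abundancy_sq x * abundancy_sq y * (abundancy_sq z * (abundancy_sq w * abundancy_sq v))"
    if "0 < x" "x \<le> p" "0 < y" "y \<le> q" "0 < z" "z \<le> a" "0 < w" "w \<le> b" "0 < v" "v \<le> c" for x y z w v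
    using that assms order_trans [OF zero_le_one abundancy_sq_ge_1]
    by (intro abundancy_lower) (auto intro!: mult_mono abundancy_sq_antimono power_mono)
  note num = abundancy_sq_def
  have d13: "13 = p \<or> 13 = q \<or> 13 \<in> ?T" by (rule dvd) auto
  have "a = 5 \<or> a \<ge> 11" using a_cases by auto
  moreover have "b \<le> 11 \<or> b \<ge> 17" using b_cases by auto
  moreover have "c \<le> 17 \<or> c \<ge> 23" using c_cases by auto
  ultimately consider (a5) "a = 5" | (a11) "a \<ge> 11" "b \<ge> 17" "c \<ge> 23"
    using assms(2,3) by linarith
  then show False
  proof cases
    case a5
    \<comment> \<open>The factors of \<open>b\<close> and \<open>c\<close> are at least 1 and are
      dropped.\<close>
    have up: "13 / 9 * abundancy_sq x * abundancy_sq y * abundancy_sq 5 < 2"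
      if "p \<le> x" "q \<le> y \<or> y = 0" for x y
    proof (rule abundancy_upper)
      have "1 * 1 \<le> abundancy_sq b * abundancy_sq c"
        using abundancy_sq_ge_1 order_trans [OF zero_le_one abundancy_sq_ge_1] by (intro mult_mono) auto
      then show "abundancy_sq 5 \<le> (\<Prod>u\<in>U. abundancy_sq u)"
        using assms a5 order_trans [OF zero_le_one abundancy_sq_ge_1, of 5]
        by (simp add: mult_le_cancel_left1)
    qed (use that p_ge q_ge order_trans [OF zero_le_one abundancy_sq_ge_1] in \<open>auto intro!: abundancy_sq_antimono\<close>)
    have d31: "31 = p \<or> 31 = q \<or> 31 \<in> ?T" by (rule dvd) (auto simp: a5)
    have "p \<noteq> 7" using up [of 7 0] by (auto simp: num)
    then consider (p13) "p = 13" | (p19) "p \<ge> 19" using p_cases by linarith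
    then show False
    proof cases
      case p13
      have "q \<noteq> 31" using up [of 13 31] p13 by (auto simp: num)
      then have T31: "31 \<in> ?T" using d31 p13 by auto
      have "61 = p \<or> 61 = q \<or> 61 \<in> ?T" by (rule dvd) (auto simp: p13)
      \<comment> \<open>31 is the only prime of \<open>m\<close>, so 61 must be \<open>q\<close>,
        which in turn brings in 97.\<close>
      then have "q = 61" using no2 [OF T31, of 61] p13 by auto
      moreover from this have "97 = p \<or> 97 = q \<or> 97 \<in> ?T" by (intro dvd) auto
      ultimately show False using no2 [OF T31, of 97] p13 by auto
    next
      case p19
      then have T13: "13 \<in> ?T" using d13 p_less_q by auto
      then have pq31: "p = 31 \<or> q = 31" using d31 no2 [OF T13, of 31] by auto
      then have "331 = p \<or> 331 = q \<or> 331 \<in> ?T" by (intro dvd) auto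
      then have "q = 331" using pq31 no2 [OF T13, of 331] p_less_q by auto
      \<comment> \<open>331^2 + 331 + 1 = 3 * 7 * 5233.\<close>
      then have "7 = p \<or> 7 = q \<or> 7 \<in> ?T" by (intro dvd) auto
      then show False using no2 [OF T13, of 7] p19 p_less_q by auto
    qed
  next
    case a11
    consider (p7) "p = 7" | (p13) "p = 13" "q \<ge> 19" | (p19) "p \<ge> 19" "q \<ge> 31"
      using p_cases q_cases p_less_q by linarith
    then show False
    proof cases
      case p7
      have d19: "19 = p \<or> 19 = q \<or> 19 \<in> ?T" by (rule dvd) (auto simp: p7)
      consider "q = 13" | "q = 19" | "13 \<in> ?T" "19 \<in> ?T" using d13 d19 p7 by auto
      then show False
      proof cases
        assume q: "q = 13"
        then have "61 = p \<or> 61 = q \<or> 61 \<in> ?T" by (intro dvd) auto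
        then show False using d19 no2 [of 19 61] p7 q by auto
      next
        assume q: "q = 19"
        then have "127 = p \<or> 127 = q \<or> 127 \<in> ?T" by (intro dvd) auto
        then show False using d13 no2 [of 13 127] p7 q by auto
      qed (use no2 [of 13 19] in auto)
    next
      case p13
      have "61 = p \<or> 61 = q \<or> 61 \<in> ?T" by (rule dvd) (auto simp: p13)
      moreover have "q \<noteq> 61" using low [of 13 61 11 17 23] a11 p13 by (auto simp: num)
      ultimately have T61: "61 \<in> ?T" using p13 by auto
      show False
      proof (cases "a = 11")
        case True
        then have "7 = p \<or> 7 = q \<or> 7 \<in> ?T" by (intro dvd) auto
        then show False using no2 [OF T61, of 7] p13 by auto
      next
        case False
        then have "a \<ge> 17" using a_cases a11 by auto
        moreover have "b \<le> 17 \<or> b \<ge> 23" using b_cases by auto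
        moreover have "c \<le> 23 \<or> c \<ge> 29" using c_cases by auto
        ultimately have "a \<ge> 17" "b \<ge> 23" "c \<ge> 29" using assms(2,3) by linarith+
        then show False using low [of 13 19 17 23 29] p13 by (simp add: num)
      qed
    next
      case p19
      then show False using low [of 19 31 11 17 23] a11 by (simp add: num)
    qed
  qed
qed
end

section \<open>Reduction to the case analysis\<close>

text \<open>Cancelling 2 leaves \<open>sigma k * ((m + 1) / 2) = k * m\<close>, which is odd. A
  prime \<open>p\<close> dividing \<open>k\<close> only once would give \<open>sigma k\<close> the
  even factor \<open>p + 1\<close>; so by cube-freeness every exponent in \<open>k\<close> is 2, and
  no prime of \<open>k\<close> divides \<open>m\<close>.\<close>

lemma cube_free_descartes_structure:
  assumes "cube_free_descartes_number n"
  obtains S m where "finite S" "\<And>p. p \<in> S \<Longrightarrow> prime p" "\<And>p. p \<in> S \<Longrightarrow> odd p" "m mod 4 = 1"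
    "n = (\<Prod>p\<in>S. p\<^sup>2) * m" "prime_factors n = S \<union> prime_factors m" "S \<inter> prime_factors m = {}"
    "(\<Prod>p\<in>S. p\<^sup>2 + p + 1) * (m + 1) = 2 * (\<Prod>p\<in>S. p\<^sup>2) * m"
proof -
  from assms have cube_free: "\<And>p. prime p \<Longrightarrow> \<not> p ^ 3 dvd n" and "odd n"
    unfolding cube_free_descartes_number_def descartes_number_def by blast+
  from assms obtain k m where km: "k > 0" "m > 0" "n = k * m" "sigma k * (m + 1) = 2 * k * m"
    unfolding cube_free_descartes_number_def descartes_number_def by blast
  define S where "S = prime_factors k"
  have "odd k" "odd m" using \<open>odd n\<close> km by auto
  then obtain j where j: "m + 1 = 2 * j" by (metis even_plus_one_iff dvdE)
  from km(4) have "2 * (sigma k * j) = 2 * (k * m)" unfolding j by (simp only: mult_ac)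
  then have "sigma k * j = k * m" by simp
  then have "odd (sigma k * j)" using \<open>odd k\<close> \<open>odd m\<close> by simp
  then have "odd (sigma k)" "odd j" by simp_all
  have m4: "m mod 4 = 1" using j \<open>odd j\<close> by presburger
  have S: "prime p" "p dvd k" "odd p" if "p \<in> S" for p
    using that \<open>odd k\<close> dvd_trans [of 2 p k] by (auto simp: S_def prime_factors_dvd)
  have square_dvd: "p\<^sup>2 dvd k" if "p \<in> S" for p
  proof (rule ccontr)
    assume "\<not> p\<^sup>2 dvd k"
    from S[OF that] obtain k' where k': "k = p * k'" by blast
    with \<open>\<not> p\<^sup>2 dvd k\<close> have "\<not> p dvd k'" by (simp add: power2_eq_square)
    then have "coprime p k'" by (rule prime_imp_coprime [OF S(1) [OF that]])
    then have "sigma k = (p + 1) * sigma k'"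
      using k' km(1) S[OF that] by (simp add: sigma_mult_coprime sigma_prime)
    with \<open>odd (sigma k)\<close> S(3) [OF that] show False by simp
  qed
  have "multiplicity p k = 2" if "p \<in> S" for p
  proof (rule multiplicity_eqI)
    show "p\<^sup>2 dvd k" by (rule square_dvd [OF that])
    show "\<not> p ^ Suc 2 dvd k" using cube_free [OF S(1) [OF that]] km(3) by (auto simp: numeral_3_eq_3 numeral_2_eq_2)
  qed
  then have k: "k = (\<Prod>p\<in>S. p\<^sup>2)"
    using prime_factorization_nat [OF km(1)] unfolding S_def by simp
  have "finite S" by (simp add: S_def)
  have "S \<inter> prime_factors m = {}"
  proof (rule ccontr)
    assume "S \<inter> prime_factors m \<noteq> {}"
    then obtain p where p: "p \<in> S" "p dvd m" by (auto simp: prime_factors_dvd)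
    then have "p\<^sup>2 * p dvd k * m" by (intro mult_dvd_mono square_dvd)
    with cube_free [OF S(1) [OF p(1)]] km(3) show False by (simp add: power2_eq_square power3_eq_cube)
  qed
  moreover have "prime_factors n = S \<union> prime_factors m"
    using km(1-3) by (simp add: S_def prime_factors_product)
  moreover have "sigma k = (\<Prod>p\<in>S. p\<^sup>2 + p + 1)"
    unfolding k by (rule sigma_prod_prime_squares) (use S \<open>finite S\<close> in auto)
  ultimately show ?thesis
    using that [of S m] \<open>finite S\<close> S m4 km(3,4) k by simp
qed

text \<open>Without 3 the abundancy 2 m / (m + 1) is below 1.93, which leaves six values of
  \<open>m\<close>. Each of them forces 3 to divide \<open>k\<close>, or a prime that is 2 modulo 3
  to divide \<open>sigma k\<close>.\<close>

lemma cube_free_descartes_three_mem: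
  fixes S :: "nat set" and m :: nat
  assumes S: "finite S" "\<And>p. p \<in> S \<Longrightarrow> prime p" "\<And>p. p \<in> S \<Longrightarrow> odd p" and m: "m mod 4 = 1" "m \<noteq> 1"
    and eq: "(\<Prod>p\<in>S. p\<^sup>2 + p + 1) * (m + 1) = 2 * (\<Prod>p\<in>S. p\<^sup>2) * m"
    and card: "card S \<le> 6"
  shows "3 \<in> S"
proof (rule ccontr)
  assume neg: "3 \<notin> S"
  define k where "k = (\<Prod>p\<in>S. p\<^sup>2)"
  define s where "s = (\<Prod>p\<in>S. p\<^sup>2 + p + 1)"
  have eq: "s * (m + 1) = 2 * k * m" using eq by (simp only: k_def s_def)
  have mem: "p \<in> S" if "prime p" "p dvd k" for p
    using that S unfolding k_def prime_dvd_prod_iff [OF S(1) that(1)]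
    by (metis prime_dvd_power primes_dvd_imp_eq)
  then have "\<not> 3 dvd k" using neg by auto
  have dvd_k: "r dvd k" if "r dvd b * k" "prime r" "\<not> r dvd b" for r b
    using that by (simp add: prime_dvd_mult_iff)
  have square_dvd: "p\<^sup>2 dvd k" if "p \<in> S" for p
    unfolding k_def by (rule dvd_prodI [OF S(1) that])
  have sigma_not_dvd: "\<not> p dvd s" if p: "p \<in> S" "p mod 3 = 2" for p
  proof
    assume "p dvd s"
    then obtain x where "p dvd x\<^sup>2 + x + 1"
      unfolding s_def prime_dvd_prod_iff [OF S(1) S(2) [OF p(1)]] by blast
    then show False using prime_dvd_cyclotomic3 [of p x] S(2) [OF p(1)] p(2) by auto
  qed
  have sigma_dvd: "3 dvd s" if "p \<in> S" "p mod 3 = 1" for p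
    using that dvd_prodI [OF S(1) that(1), of "\<lambda>p. p\<^sup>2 + p + 1"] unfolding s_def
    by (meson dvd_trans three_dvd_cyclotomic3_iff)
  have "k > 0" using S unfolding k_def by (intro prod_pos) (auto simp: prime_gt_0_nat)
  \<comment> \<open>At most six primes: the worst case is the six smallest ones above 3, and 23 is
    the next.\<close>
  have "(\<Prod>p\<in>S. abundancy_sq p) \<le> (\<Prod>p\<leftarrow>[5, 7, 11, 13, 17, 19]. abundancy_sq p)"
  proof (rule prod_antimono_le_prod_list [where N = 23])
    fix p assume p: "p \<in> S"
    then have "prime p" "odd p" "p \<noteq> 3" using S neg by auto
    then have "\<not> 3 dvd p" using primes_dvd_imp_eq [of 3 p] by auto
    then have "p mod 3 = 1 \<or> p mod 3 = 2" by presburger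
    then show "p \<in> set [5, 7, 11, 13, 17, 19] \<or> 23 \<le> p"
      using prime_1_mod_3_cases [OF \<open>prime p\<close>] prime_2_mod_3_cases [OF \<open>prime p\<close> \<open>odd p\<close>] by auto
  qed (use S(1) card abundancy_sq_antimono abundancy_sq_ge_1 in auto)
  also have "\<dots> < 193 / 100" by (simp add: abundancy_sq_def)
  finally have "(\<Prod>p\<in>S. abundancy_sq p) * real k < 193 / 100 * real k" using \<open>k > 0\<close> by simp
  also have "(\<Prod>p\<in>S. abundancy_sq p) * real k = real s"
    unfolding k_def s_def by (rule prod_abundancy_sq) (use S prime_gt_0_nat in blast)
  finally have "real (100 * s) < real (193 * k)" by simp
  then have "100 * s < 193 * k" by (simp only: of_nat_less_iff)
  then have "100 * s * (m + 1) < 193 * k * (m + 1)" by (rule mult_strict_right_mono) simp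
  also have "100 * s * (m + 1) = k * (200 * m)" using eq by simp
  finally have "k * (200 * m) < k * (193 * (m + 1))" by (simp only: mult_ac)
  then have "m < 28" by simp
  then have "m = 5 \<or> m = 9 \<or> m = 13 \<or> m = 17 \<or> m = 21 \<or> m = 25" using m by presburger
  then consider "m = 5" | "m = 9" | "m = 13" | "m = 17" | "m = 21" | "m = 25" by blast
  then show False
  proof cases
    assume "m = 5"
    with eq have *: "3 * s = 5 * k" by simp
    have "3 dvd 5 * k" unfolding * [symmetric] by simp
    then have "3 dvd k" by (rule dvd_k) simp_all
    with \<open>\<not> 3 dvd k\<close> show False by simp
  next
    assume "m = 9"
    with eq have *: "5 * s = 9 * k" by simp
    have "5 dvd 9 * k" unfolding * [symmetric] by simp
    then have "5 dvd k" by (rule dvd_k) simp_all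
    then have "5 \<in> S" by (intro mem) auto
    \<comment> \<open>25 divides \<open>k\<close>, but only one factor 5 cancels against the left
      side, so 5 still divides \<open>s\<close>.\<close>
    with square_dvd [of 5] obtain l where "k = 25 * l" by auto
    with * have "s = 5 * (9 * l)" by simp
    then have "5 dvd s" by simp
    with sigma_not_dvd [OF \<open>5 \<in> S\<close>] show False by simp
  next
    assume "m = 13"
    with eq have *: "7 * s = 13 * k" by simp
    have "7 dvd 13 * k" unfolding * [symmetric] by simp
    then have "7 dvd k" by (rule dvd_k) simp_all
    then have "7 \<in> S" by (intro mem) auto
    \<comment> \<open>7 is 1 modulo 3, so 7^2 + 7 + 1 brings a factor 3 into \<open>s\<close> and
      hence into \<open>k\<close>.\<close>
    then have "3 dvd s" by (rule sigma_dvd) simp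
    then have "3 dvd 13 * k" unfolding * [symmetric] by simp
    then have "3 dvd k" by (rule dvd_k) simp_all
    with \<open>\<not> 3 dvd k\<close> show False by simp
  next
    assume "m = 17"
    with eq have *: "9 * s = 17 * k" by simp
    have "3 dvd 17 * k" unfolding * [symmetric] by simp
    then have "3 dvd k" by (rule dvd_k) simp_all
    with \<open>\<not> 3 dvd k\<close> show False by simp
  next
    assume "m = 21"
    with eq have *: "11 * s = 21 * k" by simp
    have "11 dvd 21 * k" unfolding * [symmetric] by simp
    then have "11 dvd k" by (rule dvd_k) simp_all
    then have "11 \<in> S" by (intro mem) auto
    with square_dvd [of 11] obtain l where "k = 121 * l" by auto
    with * have "s = 11 * (21 * l)" by simp
    then have "11 dvd s" by simp
    with sigma_not_dvd [OF \<open>11 \<in> S\<close>] show False by simp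
  next
    assume "m = 25"
    with eq have *: "13 * s = 25 * k" by simp
    have "13 dvd 25 * k" unfolding * [symmetric] by simp
    then have "13 dvd k" by (rule dvd_k) simp_all
    then have "13 \<in> S" by (intro mem) auto
    then have "3 dvd s" by (rule sigma_dvd) simp
    then have "3 dvd 25 * k" unfolding * [symmetric] by simp
    then have "3 dvd k" by (rule dvd_k) simp_all
    with \<open>\<not> 3 dvd k\<close> show False by simp
  qed
qed

section \<open>Verification of \<open>descartes_D\<close>\<close>

lemma prime_dvd_descartes_D:
  assumes "prime p" "p dvd descartes_D"
  shows "p \<in> {3, 7, 11, 13, 19, 61}"
proof -
  have "descartes_D = 3 * 3 * 7 * 7 * 11 * 11 * 13 * 13 * 19 * 19 * 61"
    by (simp add: descartes_D_def)
  with assms(2) have "p dvd 3 * 3 * 7 * 7 * 11 * 11 * 13 * 13 * 19 * 19 * 61" by (simp only:)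
  then have "p dvd 3 \<or> p dvd 7 \<or> p dvd 11 \<or> p dvd 13 \<or> p dvd 19 \<or> p dvd 61"
    unfolding prime_dvd_mult_iff [OF assms(1)] by blast
  moreover have "prime (3::nat)" "prime (7::nat)" "prime (11::nat)" "prime (13::nat)" "prime (19::nat)" "prime (61::nat)"
    by simp_all
  ultimately show ?thesis using primes_dvd_imp_eq [OF assms(1)] by blast
qed

text \<open>The witness is Descartes' own: the composite \<open>m = 22021\<close> is treated like a
  prime and contributes the factor 22022.\<close>

lemma cube_free_descartes_D: "cube_free_descartes_number descartes_D"
proof -
  have prime: "prime p" if "p \<in> {3, 7, 11, 13}" for p :: nat using that by auto
  have "sigma (3\<^sup>2 * 7\<^sup>2 * 11\<^sup>2 * 13\<^sup>2) = 13 * 57 * 133 * 183"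
    using sigma_prod_prime_squares [of "{3, 7, 11, 13}"] prime by simp
  then have "descartes_number descartes_D"
    unfolding descartes_number_def descartes_D_def
    by (intro conjI exI [of _ "3\<^sup>2 * 7\<^sup>2 * 11\<^sup>2 * 13\<^sup>2"] exI [of _ 22021]) simp_all
  moreover have "\<not> p ^ 3 dvd descartes_D" if "prime p" for p
  proof
    assume *: "p ^ 3 dvd descartes_D"
    then have "p dvd descartes_D" using dvd_trans [of p "p ^ 3"] by simp
    then have "p \<in> {3, 7, 11, 13, 19, 61}" by (rule prime_dvd_descartes_D [OF that])
    with * show False unfolding descartes_D_def by auto
  qed
  ultimately show ?thesis unfolding cube_free_descartes_number_def by blast
qed

lemma card_prime_factors_descartes_D: "card (prime_factors descartes_D) \<le> 6"
proof -
  have "prime_factors descartes_D \<subseteq> {3, 7, 11, 13, 19, 61}"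
    using prime_dvd_descartes_D by (auto simp: prime_factors_dvd)
  from card_mono [OF _ this] show ?thesis by simp
qed

section \<open>Residues modulo 3 and uniqueness\<close>

text \<open>A prime of \<open>m\<close> is coprime to \<open>m + 1\<close>, hence divides
  \<open>sigma k\<close> and is 3 or 1 modulo 3; it is not 3, which lies in
  \<open>S\<close>.\<close>

lemma prime_factors_1_mod_3:
  fixes S :: "nat set" and m :: nat
  assumes S: "finite S" "3 \<in> S" "S \<inter> prime_factors m = {}" and "m > 0"
    and eq: "(\<Prod>p\<in>S. p\<^sup>2 + p + 1) * (m + 1) = 2 * (\<Prod>p\<in>S. p\<^sup>2) * m"
  shows "m mod 3 = 1"
proof (rule mod_3_eq_1_if_primes [OF \<open>m > 0\<close>])
  fix r assume r: "prime r" "r dvd m"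
  then have "r dvd (\<Prod>p\<in>S. p\<^sup>2 + p + 1) * (m + 1)" unfolding eq by simp
  moreover have "\<not> r dvd m + 1"
    using r by (metis dvd_add_right_iff not_prime_unit)
  ultimately have "r dvd (\<Prod>p\<in>S. p\<^sup>2 + p + 1)" using r(1) by (simp only: prime_dvd_mult_iff) blast
  then obtain x where "r dvd x\<^sup>2 + x + 1"
    unfolding prime_dvd_prod_iff [OF S(1) r(1)] by blast
  then have "r = 3 \<or> r mod 3 = 1" by (rule prime_dvd_cyclotomic3 [OF r(1)])
  moreover have "r \<noteq> 3" using S(2,3) r \<open>m > 0\<close> by (auto simp: prime_factors_dvd)
  ultimately show "r mod 3 = 1" by blast
qed

text \<open>Both sides of \<open>eq\<close> are compared at 3. On the left each prime that is 1
  modulo 3 contributes exactly one factor 3 and \<open>m + 1\<close> none; on the right only the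
  square of 3 counts.\<close>

lemma card_1_mod_3:
  fixes S :: "nat set" and m :: nat
  assumes S: "finite S" "\<And>p. p \<in> S \<Longrightarrow> prime p" "3 \<in> S" and m: "m mod 3 = 1"
    and eq: "(\<Prod>p\<in>S. p\<^sup>2 + p + 1) * (m + 1) = 2 * (\<Prod>p\<in>S. p\<^sup>2) * m"
  shows "card {p \<in> S. p mod 3 = 1} = 2"
proof -
  have prime_3: "prime_elem (3::nat)" by simp
  have pos: "p > 0" if "p \<in> S" for p using S(2) [OF that] by (rule prime_gt_0_nat)
  have "multiplicity 3 (m + 1) = 0" "multiplicity 3 m = 0" "multiplicity 3 (2::nat) = 0"
    using m by (auto intro!: not_dvd_imp_multiplicity_0; presburger)+
  have "multiplicity 3 ((\<Prod>p\<in>S. p\<^sup>2 + p + 1) * (m + 1)) = multiplicity 3 (\<Prod>p\<in>S. p\<^sup>2 + p + 1)"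
    using S(1) \<open>multiplicity 3 (m + 1) = 0\<close> by (subst prime_elem_multiplicity_mult_distrib [OF prime_3]) auto
  also have "\<dots> = (\<Sum>p\<in>S. multiplicity 3 (p\<^sup>2 + p + 1))"
    by (rule prime_elem_multiplicity_prod_distrib [OF prime_3 _ S(1)]) auto
  also have "\<dots> = card {p \<in> S. p mod 3 = 1}"
    unfolding multiplicity_three_cyclotomic3 using S(1) by (simp add: sum.If_cases Int_def)
  finally have "card {p \<in> S. p mod 3 = 1} = multiplicity 3 (2 * (\<Prod>p\<in>S. p\<^sup>2) * m)"
    unfolding eq by simp
  also have "2 * (\<Prod>p\<in>S. p\<^sup>2) * m = 3 ^ 2 * (2 * (\<Prod>p\<in>S - {3}. p\<^sup>2) * m)"
    using S by (simp add: prod.remove [of S 3])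
  also have "multiplicity 3 \<dots> = 2"
  proof (rule multiplicity_eqI)
    have "\<not> 3 dvd p\<^sup>2" if "p \<in> S - {3}" for p
      using that S(2) [of p] primes_dvd_imp_eq [of 3 p] prime_dvd_power [of 3 p 2] by auto
    then have "\<not> 3 dvd (\<Prod>p\<in>S - {3}. p\<^sup>2)" using S(1) by (subst prime_dvd_prod_iff) auto
    moreover have "\<not> 3 dvd m" using m by presburger
    ultimately have "\<not> 3 dvd 2 * (\<Prod>p\<in>S - {3}. p\<^sup>2) * m"
      using prime_dvd_mult_iff [of "3::nat"] primes_dvd_imp_eq [of 3 "2::nat"] by auto
    then show "\<not> 3 ^ Suc 2 dvd 3 ^ 2 * (2 * (\<Prod>p\<in>S - {3}. p\<^sup>2) * m)"
      by (simp add: power_Suc2 mult_ac)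
  qed simp
  finally show ?thesis .
qed

lemma card_2_sorted:
  fixes A :: "'a::linorder set"
  assumes "card A = 2"
  obtains a b where "A = {a, b}" "a < b"
  using assms that by (metis card_2_iff doubleton_eq_iff linorder_neq_iff)

lemma card_3_sorted:
  fixes A :: "'a::linorder set"
  assumes "card A = 3"
  obtains a b c where "A = {a, b, c}" "a < b" "b < c"
proof -
  have "finite A" "A \<noteq> {}" using assms by (auto intro: card_ge_0_finite)
  define a where "a = Min A"
  have a: "a \<in> A" "\<And>x. x \<in> A \<Longrightarrow> a \<le> x" using \<open>finite A\<close> \<open>A \<noteq> {}\<close> by (simp_all add: a_def)
  have "card (A - {a}) = 2" using a(1) assms by simp
  then obtain b c where bc: "A - {a} = {b, c}" "b < c" by (rule card_2_sorted)
  have "b \<in> A - {a}" using bc by simp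
  then have "a < b" using a(2) [of b] by auto
  moreover have "A = {a, b, c}" using bc(1) a(1) by blast
  ultimately show ?thesis using bc(2) that by blast
qed

lemma cube_free_descartes_unique:
  assumes n: "cube_free_descartes_number n" "n \<noteq> 1" "card (prime_factors n) < 8"
  shows "n = descartes_D"
proof -
  obtain S m where S: "finite S" "\<And>p. p \<in> S \<Longrightarrow> prime p" "\<And>p. p \<in> S \<Longrightarrow> odd p" and m4: "m mod 4 = 1"
    and nm: "n = (\<Prod>p\<in>S. p\<^sup>2) * m" and factors: "prime_factors n = S \<union> prime_factors m" "S \<inter> prime_factors m = {}"
    and eq: "(\<Prod>p\<in>S. p\<^sup>2 + p + 1) * (m + 1) = 2 * (\<Prod>p\<in>S. p\<^sup>2) * m"
    using cube_free_descartes_structure [OF n(1)] by blast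
  have "m > 0" using m4 by (cases m) auto
  have "m \<noteq> 1"
  proof
    assume "m = 1"
    \<comment> \<open>The equation now reads \<open>sigma k = k\<close>, which forces
      \<open>S\<close> to be empty and \<open>n = 1\<close>.\<close>
    then have "(\<Prod>p\<in>S. p\<^sup>2 + p + 1) = (\<Prod>p\<in>S. p\<^sup>2)" using eq by simp
    moreover have "(\<Prod>p\<in>S. p\<^sup>2) < (\<Prod>p\<in>S. p\<^sup>2 + p + 1)" if "p \<in> S" for p
      by (rule prod_mono_strict [OF that _ S(1)]) auto
    ultimately have "S = {}" by auto
    with nm \<open>m = 1\<close> n(2) show False by simp
  qed
  then obtain r where "prime r" "r dvd m" using prime_factor_nat by blast
  then have "prime_factors m \<noteq> {}" using \<open>m > 0\<close> by (auto simp: prime_factors_dvd)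
  then have T: "card (prime_factors m) \<ge> 1" by (simp add: Suc_le_eq card_gt_0_iff)
  have card: "card S + card (prime_factors m) \<le> 7"
    using n(3) unfolding factors(1) by (subst (asm) card_Un_disjoint) (use S(1) factors(2) in auto)
  have "card S \<le> 6" using T card by linarith
  with S m4 \<open>m \<noteq> 1\<close> eq have "3 \<in> S" by (rule cube_free_descartes_three_mem)
  have m3: "m mod 3 = 1"
    by (rule prime_factors_1_mod_3 [OF S(1) \<open>3 \<in> S\<close> factors(2) \<open>m > 0\<close> eq])
  have "card {p \<in> S. p mod 3 = 1} = 2"
    by (rule card_1_mod_3 [OF S(1,2) \<open>3 \<in> S\<close> m3 eq])
  then obtain p q where pq: "{p \<in> S. p mod 3 = 1} = {p, q}" "p < q" by (rule card_2_sorted)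
  then have "p \<in> {p \<in> S. p mod 3 = 1}" "q \<in> {p \<in> S. p mod 3 = 1}" by auto
  then have p: "p \<in> S" "p mod 3 = 1" and q: "q \<in> S" "q mod 3 = 1" by simp_all
  define U where "U = S - {3, p, q}"
  have SU: "S = insert 3 (insert p (insert q U))" using \<open>3 \<in> S\<close> p q by (auto simp: U_def)
  have fresh: "3 \<notin> insert p (insert q U)" "p \<notin> insert q U" "q \<notin> U" and "finite U"
    using p(2) q(2) \<open>p < q\<close> S(1) by (auto simp: U_def)
  have U_mod: "u mod 3 = 2" if "u \<in> U" for u
  proof -
    have "u \<in> S" "u \<noteq> 3" "u \<notin> {p \<in> S. p mod 3 = 1}" using that unfolding pq(1) by (auto simp: U_def)
    then have "u mod 3 \<noteq> 1" "\<not> 3 dvd u" using primes_dvd_imp_eq [of 3 u] S(2) [of u] by auto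
    then show ?thesis by presburger
  qed
  have cardS: "card S = card U + 3" unfolding SU using fresh \<open>finite U\<close> by simp
  have prod_S: "prod g S = g 3 * (g p * (g q * prod g U))" for g :: "nat \<Rightarrow> nat"
    unfolding SU using fresh \<open>finite U\<close> by simp
  \<comment> \<open>Stated for variables, so that \<open>simp\<close> evaluates only the constants
    13 and 18.\<close>
  have regroup: "13 * P * Q * A * M = 18 * p' * q' * B * m"
    if "(3\<^sup>2 + 3 + 1) * (P * (Q * A)) * M = 2 * (3\<^sup>2 * (p' * (q' * B))) * m" for P Q A M p' q' B :: nat
    using that by (simp add: mult_ac)
  interpret descartes_core p q m U
  proof
    show "13 * (p\<^sup>2 + p + 1) * (q\<^sup>2 + q + 1) * (\<Prod>u\<in>U. u\<^sup>2 + u + 1) * (m + 1) =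
        18 * p\<^sup>2 * q\<^sup>2 * (\<Prod>u\<in>U. u\<^sup>2) * m"
      using eq unfolding prod_S by (rule regroup)
  qed (use p q pq(2) S U_mod \<open>finite U\<close> m4 m3 card cardS in \<open>auto simp: U_def\<close>)
  have "card U \<noteq> 0" using U_not_empty \<open>finite U\<close> by simp
  \<comment> \<open>Besides \<open>U\<close>, the at most seven primes include 3, \<open>p\<close>,
    \<open>q\<close> and at least one prime of \<open>m\<close>.\<close>
  moreover have "card U \<le> 3" using card cardS T by linarith
  ultimately consider "card U = 1" | "card U = 2" | "card U = 3" by linarith
  then show ?thesis
  proof cases
    case 1
    then obtain a where a: "U = {a}" by (rule card_1_singletonE)
    have *: "p = 7" "q = 13" "a = 11" using U_singleton [OF a] by simp_all
    \<comment> \<open>With \<open>k\<close> known, \<open>eq\<close> is linear in \<open>m\<close>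
      and determines it.\<close>
    have "m = 22021" using descartes_core.eq [OF descartes_core_axioms] unfolding a * by simp
    moreover have "(\<Prod>p\<in>S. p\<^sup>2) = 3\<^sup>2 * 7\<^sup>2 * 11\<^sup>2 * 13\<^sup>2" unfolding SU a * by simp
    ultimately show ?thesis unfolding nm descartes_D_def by (simp only:)
  next
    case 2
    then obtain a b where "U = {a, b}" "a < b" by (rule card_2_sorted)
    then show ?thesis using U_not_doubleton by blast
  next
    case 3
    then obtain a b c where "U = {a, b, c}" "a < b" "b < c" by (rule card_3_sorted)
    then show ?thesis using U_not_tripleton by blast
  qed
qed

theorem mainTheorem2:
  fixes n :: nat
  assumes "n \<noteq> 1"
  shows "cube_free_descartes_number n \<and> card (prime_factors n) < 8 \<longleftrightarrow> n = descartes_D"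
  using cube_free_descartes_unique [OF _ assms] cube_free_descartes_D card_prime_factors_descartes_D by fastforce

end
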